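(* Every 2-degenerate graph $G$ is group $(\Delta(G)+1)$-edge-choosable.
   Context: All graphs are finite, simple and undirected; $\delta(G)$ and $\Delta(G)$ are the minimum and maximum degree of $G$. A graph $G$ is $k$-degenerate if $\delta(H)\le k$ for every subgraph $H\subseteq G$. Let $H$ be a graph, $A$ an Abelian group, and fix an arbitrary orientation $D$ of $E(H)$. For a function $f:E(H)\to A$, an $(A,f)$-coloring of $H$ is a map $c:V(H)\to A$ such that $c(u)-c(v)\ne f(uv)$ for every edge $uv$ directed from $u$ to $v$. $H$ is group $k$-choosable if for every Abelian group $A$ of order at least $k$, every list assignment $L:V(H)\to 2^A$ with $|L(v)|=k$ for all $v$, and every $f:E(H)\to A$, there is an $(A,f)$-coloring $c$ of $H$ with $c(v)\in L(v)$ for all $v\in V(H)$ (this does not depend on $D$). A graph $G$ is group $k$-edge-choosable if its line graph $\mathcal{L}(G)$ (vertices are the edges of $G$, two adjacent iff the edges share an endpoint) is group $k$-choosable. *)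

theory Defs
  imports "HOL-Algebra.Coset"
begin

record 'a ugraph =
  verts :: "'a set"
  edges :: "'a set set"

definition simple_graph :: "'a ugraph \<Rightarrow> bool" where
  "simple_graph G \<longleftrightarrow> finite (verts G) \<and> (\<forall>e\<in>edges G. e \<subseteq> verts G \<and> card e = 2)"

definition subgraph :: "'a ugraph \<Rightarrow> 'a ugraph \<Rightarrow> bool" where
  "subgraph H G \<longleftrightarrow> simple_graph H \<and> verts H \<subseteq> verts G \<and> edges H \<subseteq> edges G"

definition vdegree :: "'a ugraph \<Rightarrow> 'a \<Rightarrow> nat" where
  "vdegree G v = card {e \<in> edges G. v \<in> e}"

(* The case split only fixes a value for the graph without vertices, where Min and Max
   would be unspecified. *)

definition min_degree :: "'a ugraph \<Rightarrow> nat" where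
  "min_degree G = (if verts G = {} then 0 else Min (vdegree G ` verts G))"

definition max_degree :: "'a ugraph \<Rightarrow> nat" where
  "max_degree G = (if verts G = {} then 0 else Max (vdegree G ` verts G))"

definition degenerate :: "nat \<Rightarrow> 'a ugraph \<Rightarrow> bool" where
  "degenerate k G \<longleftrightarrow> (\<forall>H. subgraph H G \<longrightarrow> min_degree H \<le> k)"

definition line_graph :: "'a ugraph \<Rightarrow> 'a set ugraph" where
  "line_graph G =
     \<lparr>verts = edges G,
      edges = {{e, e'} | e e'. e \<in> edges G \<and> e' \<in> edges G \<and> e \<noteq> e' \<and> e \<inter> e' \<noteq> {}}\<rparr>"

(* (u, v) \<in> D means that the edge {u, v} is directed from u to v; bijectivity says that
   every edge is directed in exactly one of its two directions. *)

definition orientation :: "'a ugraph \<Rightarrow> ('a \<times> 'a) set \<Rightarrow> bool" where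
  "orientation H D \<longleftrightarrow> bij_betw (\<lambda>(u, v). {u, v}) D (edges H)"

(* Groups are written multiplicatively, so c(u) - c(v) becomes c u \<otimes> inv (c v). *)

definition group_coloring ::
  "'g monoid \<Rightarrow> 'a ugraph \<Rightarrow> ('a \<times> 'a) set \<Rightarrow> ('a set \<Rightarrow> 'g) \<Rightarrow> ('a \<Rightarrow> 'g) \<Rightarrow> bool" where
  "group_coloring A H D f c \<longleftrightarrow>
     (\<forall>v\<in>verts H. c v \<in> carrier A) \<and>
     (\<forall>(u, v)\<in>D. c u \<otimes>\<^bsub>A\<^esub> inv\<^bsub>A\<^esub> (c v) \<noteq> f {u, v})"

(* HOL cannot quantify over types inside a definition, so the type 'g in which the groups
   have their carriers is a parameter: A ranges over all Abelian groups whose carrier is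
   a subset of 'g, and a theorem polymorphic in 'g covers all Abelian groups.  Groups may
   be infinite; since order is 0 for these, they are admitted separately.  The property
   does not depend on the orientation D; it is required here for all of them. *)

definition group_choosable :: "'g itself \<Rightarrow> nat \<Rightarrow> 'a ugraph \<Rightarrow> bool" where
  "group_choosable (TYPE('g)) k H \<longleftrightarrow>
     (\<forall>(A :: 'g monoid) D L f.
        comm_group A \<longrightarrow> infinite (carrier A) \<or> k \<le> order A \<longrightarrow>
        orientation H D \<longrightarrow>
        (\<forall>v\<in>verts H. L v \<subseteq> carrier A \<and> finite (L v) \<and> card (L v) = k) \<longrightarrow>
        (\<forall>e\<in>edges H. f e \<in> carrier A) \<longrightarrow>
        (\<exists>c. group_coloring A H D f c \<and> (\<forall>v\<in>verts H. c v \<in> L v)))"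

definition group_edge_choosable :: "'g itself \<Rightarrow> nat \<Rightarrow> 'a ugraph \<Rightarrow> bool" where
  "group_edge_choosable (TYPE('g)) k G \<longleftrightarrow> group_choosable TYPE('g) k (line_graph G)"

end

theory Submission
  imports Defs
begin

text \<open>
  A greedy argument proves the theorem: the line graph of a 2-degenerate graph \<open>G\<close> is
  \<open>\<Delta>(G)\<close>-degenerate, and every \<open>k\<close>-degenerate graph is group \<open>(k + 1)\<close>-choosable.

  For the first claim (\<open>degenerate_line_graph\<close>), take a nonempty set \<open>S\<close> of edges of \<open>G\<close>.  The
  graph that they form has no isolated vertex, and degeneracy gives a vertex \<open>v\<close> that lies on at
  most two edges of \<open>S\<close>.  Pick an edge \<open>{v, w}\<close> of \<open>S\<close>.  It meets at most one further edge of
  \<open>S\<close> at \<open>v\<close> and at most \<open>\<Delta>(G) - 1\<close> further ones at \<open>w\<close>, so it has degree at most \<open>\<Delta>(G)\<close>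
  in the part of the line graph that is spanned by \<open>S\<close>.

  For the second claim (\<open>degenerate_imp_group_choosable\<close>), remove a vertex \<open>v\<close> of degree at most
  \<open>k\<close>, color the rest inductively, and then color \<open>v\<close>.  In a group, each colored neighbour of
  \<open>v\<close> excludes exactly one color at \<open>v\<close>, whatever the direction and the label of the edge, so one
  of the \<open>k + 1\<close> colors in the list of \<open>v\<close> remains.
\<close>

lemma finite_edges:
  assumes "simple_graph G"
  shows "finite (edges G)"
proof (rule finite_subset)
  show "edges G \<subseteq> Pow (verts G)"
    using assms by (auto simp: simple_graph_def)
  show "finite (Pow (verts G))"
    using assms by (simp add: simple_graph_def)
qed

lemma vdegree_le_max_degree:
  assumes "simple_graph G" "v \<in> verts G"
  shows "vdegree G v \<le> max_degree G"
  using assms by (auto simp: max_degree_def simple_graph_def)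

lemma min_degree_attained:
  assumes "simple_graph G" "verts G \<noteq> {}"
  obtains v where "v \<in> verts G" "vdegree G v = min_degree G"
proof -
  have "Min (vdegree G ` verts G) \<in> vdegree G ` verts G"
    using assms by (intro Min_in) (auto simp: simple_graph_def)
  then have "min_degree G \<in> vdegree G ` verts G"
    using assms(2) by (simp add: min_degree_def)
  then show ?thesis
    using that by (metis imageE)
qed

lemma min_degree_le_vdegree:
  assumes "simple_graph G" "v \<in> verts G"
  shows "min_degree G \<le> vdegree G v"
  using assms by (auto simp: min_degree_def simple_graph_def)

lemma simple_line_graph:
  assumes "simple_graph G"
  shows "simple_graph (line_graph G)"
  using finite_edges[OF assms] by (auto simp: simple_graph_def line_graph_def card_2_iff)

text \<open>The bound applies degeneracy to the subgraph of \<open>H\<close> that \<open>S\<close> induces.\<close>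

lemma degenerate_few_neighbours:
  assumes H: "simple_graph H" "degenerate k H" and S: "S \<subseteq> verts H" "S \<noteq> {}"
  obtains v where "v \<in> S" "card {u \<in> S. {u, v} \<in> edges H} \<le> k"
proof -
  define K where "K = \<lparr>verts = S, edges = {e \<in> edges H. e \<subseteq> S}\<rparr>"
  have K: "simple_graph K"
    using H(1) S(1) by (auto simp: simple_graph_def K_def intro: finite_subset)
  with S(1) have "subgraph K H"
    by (auto simp: subgraph_def K_def)
  with H(2) have "min_degree K \<le> k"
    by (simp add: degenerate_def)
  moreover have "verts K \<noteq> {}"
    using S(2) by (simp add: K_def)
  ultimately obtain v where v: "v \<in> S" "vdegree K v \<le> k"
    using min_degree_attained[OF K] by (metis K_def ugraph.select_convs(1))
  have "card {u \<in> S. {u, v} \<in> edges H} = card ((\<lambda>u. {u, v}) ` {u \<in> S. {u, v} \<in> edges H})"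
    by (rule card_image[symmetric]) (auto simp: inj_on_def doubleton_eq_iff)
  also have "\<dots> \<le> vdegree K v"
    unfolding vdegree_def using finite_edges[OF H(1)] v(1) by (intro card_mono) (auto simp: K_def)
  finally show ?thesis
    using that v by simp
qed

text \<open>
  The greedy argument; the induction colors ever larger sets \<open>S\<close> of vertices, respecting the edges
  inside \<open>S\<close>.
\<close>

lemma degenerate_imp_group_choosable:
  assumes H: "simple_graph H" "degenerate k H"
  shows "group_choosable TYPE('g) (k + 1) H"
  unfolding group_choosable_def
proof (intro allI impI)
  fix A :: "'g monoid" and D L f
  assume "comm_group A" and D: "orientation H D"
    and L: "\<forall>v\<in>verts H. L v \<subseteq> carrier A \<and> finite (L v) \<and> card (L v) = k + 1"
    and f: "\<forall>e\<in>edges H. f e \<in> carrier A"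
  interpret comm_group A by fact
  have D_edges: "{u, v} \<in> edges H" if "(u, v) \<in> D" for u v
    using D that by (auto simp: orientation_def bij_betw_def)
  have edge_verts: "u \<in> verts H" "v \<in> verts H" "u \<noteq> v" if "{u, v} \<in> edges H" for u v
    using H(1) that by (auto simp: simple_graph_def)
  have D_antisym: "(v, u) \<notin> D" if "(u, v) \<in> D" for u v
  proof
    assume "(v, u) \<in> D"
    moreover have "inj_on (\<lambda>(u, v). {u, v}) D"
      using D by (simp add: orientation_def bij_betw_def)
    ultimately have "(u, v) = (v, u)"
      using that by (auto dest!: inj_onD[where x = "(u, v)" and y = "(v, u)"])
    then show False
      using edge_verts(3)[OF D_edges[OF that]] by simp
  qed
  define good where "good S c \<longleftrightarrow> (\<forall>v\<in>S. c v \<in> L v) \<and>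
    (\<forall>u\<in>S. \<forall>v\<in>S. (u, v) \<in> D \<longrightarrow> c u \<otimes>\<^bsub>A\<^esub> inv\<^bsub>A\<^esub> (c v) \<noteq> f {u, v})" for S c
  have partial: "\<exists>c. good S c" if "S \<subseteq> verts H" for S
    using that
  proof (induction "card S" arbitrary: S)
    case 0
    then have "S = {}"
      using H(1) by (metis card_0_eq finite_subset simple_graph_def)
    then show ?case
      by (simp add: good_def)
  next
    case (Suc n)
    have fin: "finite S"
      using H(1) Suc.prems by (auto simp: simple_graph_def intro: finite_subset)
    from Suc.hyps(2) have "S \<noteq> {}"
      by auto
    then obtain v where v: "v \<in> S" "card {u \<in> S. {u, v} \<in> edges H} \<le> k"
      using degenerate_few_neighbours[OF H Suc.prems] by metis
    have "n = card (S - {v})" "S - {v} \<subseteq> verts H"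
      using Suc.hyps(2) Suc.prems v(1) by auto
    then obtain c where c: "good (S - {v}) c"
      using Suc.hyps(1) by blast
    let ?N = "{u \<in> S. {u, v} \<in> edges H}"
    (* The one color at v that the colored neighbour u excludes: the equation for the directed
       edge between them, solved for the color of v. *)
    define excluded where
      "excluded u = (if (v, u) \<in> D then f {u, v} \<otimes>\<^bsub>A\<^esub> c u else inv\<^bsub>A\<^esub> (f {u, v}) \<otimes>\<^bsub>A\<^esub> c u)" for u
    have "card (excluded ` ?N) \<le> k"
      using card_image_le[of ?N excluded] fin v(2) by simp
    also have "\<dots> < card (L v)"
      using L v(1) Suc.prems by auto
    finally have "\<not> L v \<subseteq> excluded ` ?N"
      using card_mono[of "excluded ` ?N" "L v"] fin by auto
    then obtain x where x: "x \<in> L v" "x \<notin> excluded ` ?N"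
      by blast
    have x_car: "x \<in> carrier A"
      using x(1) L v(1) Suc.prems by auto
    have c_car: "c u \<in> carrier A" if "u \<in> S - {v}" for u
      using that c L Suc.prems by (auto simp: good_def)
    have out: "x \<otimes>\<^bsub>A\<^esub> inv\<^bsub>A\<^esub> (c u) \<noteq> f {v, u}" if "(v, u) \<in> D" "u \<in> S - {v}" for u
    proof
      assume eq: "x \<otimes>\<^bsub>A\<^esub> inv\<^bsub>A\<^esub> (c u) = f {v, u}"
      have "x = f {v, u} \<otimes>\<^bsub>A\<^esub> c u"
        unfolding eq[symmetric] using x_car c_car[OF that(2)] by (simp add: m_assoc)
      also have "\<dots> = excluded u"
        using that(1) by (simp add: excluded_def insert_commute)
      finally show False
        using x(2) D_edges[OF that(1)] that(2) by (auto simp: insert_commute)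
    qed
    have into: "c u \<otimes>\<^bsub>A\<^esub> inv\<^bsub>A\<^esub> x \<noteq> f {u, v}" if "(u, v) \<in> D" "u \<in> S - {v}" for u
    proof
      assume eq: "c u \<otimes>\<^bsub>A\<^esub> inv\<^bsub>A\<^esub> x = f {u, v}"
      have "x = inv\<^bsub>A\<^esub> (f {u, v}) \<otimes>\<^bsub>A\<^esub> c u"
        unfolding eq[symmetric] using x_car c_car[OF that(2)]
        by (simp add: inv_mult_group m_assoc)
      also have "\<dots> = excluded u"
        using D_antisym[OF that(1)] by (simp add: excluded_def)
      finally show False
        using x(2) D_edges[OF that(1)] that(2) by auto
    qed
    have "(v, v) \<notin> D"
      using D_antisym by blast
    then have "good S (c(v := x))"
      using c x(1) out into by (auto simp: good_def)
    then show ?case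
      by blast
  qed
  obtain c where c: "good (verts H) c"
    using partial by blast
  have "group_coloring A H D f c"
    unfolding group_coloring_def
  proof (intro conjI ballI, goal_cases)
    case (1 v)
    then show ?case
      using c L by (auto simp: good_def)
  next
    case (2 p)
    obtain u v where p: "p = (u, v)"
      by fastforce
    then have "u \<in> verts H" "v \<in> verts H"
      using 2 edge_verts D_edges by blast+
    then show ?case
      using c 2 p by (auto simp: good_def)
  qed
  with c show "\<exists>c. group_coloring A H D f c \<and> (\<forall>v\<in>verts H. c v \<in> L v)"
    by (auto simp: good_def)
qed

text \<open>
  As soon as \<open>G\<close> has an edge, \<open>k\<close> and \<open>\<Delta>(G)\<close> are positive, and the bound is the sum of \<open>k - 1\<close>
  and \<open>\<Delta>(G) - 1\<close>, which count the further edges at the two ends of an edge.  If \<open>G\<close> has no edge,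
  its line graph is empty, so that the truncated subtraction is harmless.
\<close>

lemma degenerate_line_graph:
  assumes G: "simple_graph G" and deg: "degenerate k G"
  shows "degenerate (max_degree G + k - 2) (line_graph G)"
  unfolding degenerate_def
proof (intro allI impI)
  fix H
  assume sub: "subgraph H (line_graph G)"
  define S where "S = verts H"
  have S: "S \<subseteq> edges G"
    using sub by (simp add: subgraph_def line_graph_def S_def)
  have finS: "finite S"
    using S finite_edges[OF G] by (rule finite_subset)
  show "min_degree H \<le> max_degree G + k - 2"
  proof (cases "S = {}")
    case True
    then show ?thesis
      by (simp add: min_degree_def S_def)
  next
    case False
    define K where "K = \<lparr>verts = \<Union>S, edges = S\<rparr>"
    have two: "e \<subseteq> verts G" "card e = 2" if "e \<in> S" for e
      using G S that by (auto simp: simple_graph_def)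
    have K: "simple_graph K"
      unfolding simple_graph_def K_def using G two by (auto simp: simple_graph_def intro: finite_subset)
    have "subgraph K G"
      using K S two by (auto simp: subgraph_def K_def)
    then have "min_degree K \<le> k"
      using deg by (simp add: degenerate_def)
    moreover have "verts K \<noteq> {}"
      using False two by (fastforce simp: K_def)
    ultimately obtain v where "v \<in> \<Union>S" and v: "vdegree K v \<le> k"
      using min_degree_attained[OF K] by (metis K_def ugraph.select_convs(1))
    then obtain e where e: "e \<in> S" "v \<in> e"
      by blast
    then obtain w where w: "e = {v, w}"
      using two(2)[OF e(1)] by (auto simp: card_2_iff)
    define at where "at x = {e' \<in> S. x \<in> e'}" for x
    have fin_at: "finite (at x)" for x
      using finS by (simp add: at_def)
    have at_e: "e \<in> at v" "e \<in> at w"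
      using e w by (auto simp: at_def)
    have at_v: "card (at v) \<le> k"
      using v by (simp add: vdegree_def K_def at_def)
    have "card (at w) \<le> vdegree G w"
      unfolding vdegree_def at_def using S finite_edges[OF G] by (intro card_mono) auto
    also have "\<dots> \<le> max_degree G"
      using two(1)[OF e(1)] w by (intro vdegree_le_max_degree[OF G]) auto
    finally have at_w: "card (at w) \<le> max_degree G" .
    have pos: "card (at v) > 0" "card (at w) > 0"
      using at_e fin_at by (auto simp: card_gt_0_iff)
    let ?N = "(at v - {e}) \<union> (at w - {e})"
    have "min_degree H \<le> vdegree H e"
      using sub e(1) by (intro min_degree_le_vdegree) (auto simp: subgraph_def S_def)
    also have "\<dots> \<le> card ((\<lambda>e'. {e, e'}) ` ?N)"
      unfolding vdegree_def
    proof (rule card_mono)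
      show "finite ((\<lambda>e'. {e, e'}) ` ?N)"
        using fin_at by simp
      show "{x \<in> edges H. e \<in> x} \<subseteq> (\<lambda>e'. {e, e'}) ` ?N"
      proof
        fix x
        assume x: "x \<in> {x \<in> edges H. e \<in> x}"
        then have "x \<in> edges (line_graph G)" "x \<subseteq> S"
          using sub by (auto simp: subgraph_def simple_graph_def S_def)
        then obtain a b where ab: "x = {a, b}" "a \<noteq> b" "a \<inter> b \<noteq> {}"
          by (auto simp: line_graph_def)
        with x obtain e' where e': "x = {e, e'}" "e \<noteq> e'" "e \<inter> e' \<noteq> {}"
          by blast
        with \<open>x \<subseteq> S\<close> w have "e' \<in> ?N"
          by (auto simp: at_def)
        with e'(1) show "x \<in> (\<lambda>e'. {e, e'}) ` ?N"
          by blast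
      qed
    qed
    also have "\<dots> \<le> card ?N"
      using fin_at by (intro card_image_le) auto
    also have "\<dots> \<le> card (at v - {e}) + card (at w - {e})"
      by (rule card_Un_le)
    also have "\<dots> = (card (at v) - 1) + (card (at w) - 1)"
      using at_e by (simp add: card_Diff_singleton)
    also have "\<dots> \<le> max_degree G + k - 2"
      using at_v at_w pos by linarith
    finally show ?thesis .
  qed
qed

theorem corollary2p3:
  fixes G :: "'a ugraph"
  assumes "simple_graph G" and "degenerate 2 G"
  shows "group_edge_choosable TYPE('g) (max_degree G + 1) G"
  using degenerate_imp_group_choosable[OF simple_line_graph[OF assms(1)]]
    degenerate_line_graph[OF assms]
  by (simp add: group_edge_choosable_def)

end
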